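(* Let $R$ be a finite rack with operations $\triangleright,\triangleleft$, let $G$ be an arbitrary group structure on the underlying set of $R$ (no compatibility with the rack operations is assumed), and let $\mathcal G=(\mathrm{id}\colon G\to G,\mathrm{ad})$ be the crossed module given by the identity map and the adjoint (conjugation) action of $G$ on itself. Define $\psi,\phi\colon G\times G\to G$ by $$\psi(b,a)=b\,a\,b^{-1}\,(b\triangleright a)^{-1},\qquad \phi(b,a)=a\,b\,(a\triangleleft b)^{-1}\,b^{-1}.$$ Then $\Phi=(\psi,\phi)$ is a framed Reidemeister pair for $\mathcal G$. Moreover, if $R$ is a quandle, then $\Phi$ is an unframed Reidemeister pair for $\mathcal G$.
   Context: **Racks and quandles.** A rack is a set $R$ with two operations $\triangleright,\triangleleft\colon R\times R\to R$ such that for all $x,y,z\in R$: $x\triangleright(y\triangleleft x)=y$; $(x\triangleright y)\triangleleft x=y$; $x\triangleright(y\triangleright z)=(x\triangleright y)\triangleright(x\triangleright z)$; $(x\triangleleft y)\triangleleft z=(x\triangleleft z)\triangleleft(y\triangleleft z)$. A quandle is a rack with $x\triangleleft x=x=x\triangleright x$ for all $x$. **Crossed modules.** A crossed module of groups $(\partial\colon E\to G,\bullet)$ is a group homomorphism $\partial\colon E\to G$ with a left action $\bullet$ of $G$ on $E$ by automorphisms such that $\partial(g\bullet e)=g\,\partial(e)\,g^{-1}$ and $\partial(e)\bullet f=efe^{-1}$ for all $g\in G$, $e,f\in E$. **Reidemeister pairs.** For a crossed module $(\partial\colon E\to G,\bullet)$, a pair $\Phi=(\psi,\phi)$ of functions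 $\psi,\phi\colon G\times G\to E$ is an *unframed Reidemeister pair* if for all $X,Y,T\in G$: (R1) $\psi(X,X)=1_E$; (R2) $\phi(X,Y)\,\psi(X,Z)=1_E$ where $Z=X^{-1}\partial\phi(X,Y)^{-1}YX$; (R3) $\phi(Y,X)\cdot\big(Y\bullet\phi(T,Z)\big)\cdot\phi(T,Y)=\big(X\bullet\phi(T,Y)\big)\cdot\phi(T,X)\cdot\big(T\bullet\phi(V,W)\big)$ where $Z=Y^{-1}\partial\phi(Y,X)^{-1}XY$, $V=T^{-1}\partial\phi(T,Y)^{-1}YT$, $W=T^{-1}\partial\phi(T,X)^{-1}XT$. It is a *framed Reidemeister pair* if (R2) and (R3) hold and moreover: (i) for each $Z\in G$ the equation $\partial(\phi(A,Z))A=Z$ has a unique solution $A=f(Z)\in G$; (ii) with $g(A)=\partial(\psi(A,A))^{-1}A$ one has $f\circ g=g\circ f=\mathrm{id}$. *)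

theory Defs
  imports "HOL-Algebra.Group_Action"
begin

locale rack =
  fixes R :: "'a set"
    and rtri :: "'a \<Rightarrow> 'a \<Rightarrow> 'a"  (infixl "\<triangleright>" 70)
    and ltri :: "'a \<Rightarrow> 'a \<Rightarrow> 'a"  (infixl "\<triangleleft>" 70)
  assumes rtri_closed: "\<lbrakk>x \<in> R; y \<in> R\<rbrakk> \<Longrightarrow> x \<triangleright> y \<in> R"
    and ltri_closed: "\<lbrakk>x \<in> R; y \<in> R\<rbrakk> \<Longrightarrow> x \<triangleleft> y \<in> R"
    and rtri_ltri: "\<lbrakk>x \<in> R; y \<in> R\<rbrakk> \<Longrightarrow> x \<triangleright> (y \<triangleleft> x) = y"
    and ltri_rtri: "\<lbrakk>x \<in> R; y \<in> R\<rbrakk> \<Longrightarrow> (x \<triangleright> y) \<triangleleft> x = y"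
    and rtri_distrib: "\<lbrakk>x \<in> R; y \<in> R; z \<in> R\<rbrakk> \<Longrightarrow> x \<triangleright> (y \<triangleright> z) = (x \<triangleright> y) \<triangleright> (x \<triangleright> z)"
    and ltri_distrib: "\<lbrakk>x \<in> R; y \<in> R; z \<in> R\<rbrakk> \<Longrightarrow> (x \<triangleleft> y) \<triangleleft> z = (x \<triangleleft> z) \<triangleleft> (y \<triangleleft> z)"

locale quandle = rack +
  assumes ltri_idem: "x \<in> R \<Longrightarrow> x \<triangleleft> x = x"
    and rtri_idem: "x \<in> R \<Longrightarrow> x \<triangleright> x = x"

text \<open>The library's automorphism group consists of extensional functions, so an action by
  automorphisms is a homomorphism into it, and each \<open>act g\<close> is \<open>undefined\<close> off \<open>carrier E\<close>.\<close>

locale crossed_module = E: group E + G: group G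
  for E :: "('e, 'm) monoid_scheme" and G :: "('g, 'n) monoid_scheme" +
  fixes bd :: "'e \<Rightarrow> 'g"  ("\<partial>")
    and act :: "'g \<Rightarrow> 'e \<Rightarrow> 'e"  (infixr "\<bullet>" 75)
  assumes bd_hom: "\<partial> \<in> hom E G"
    and act_hom: "act \<in> hom G (AutoGroup E)"
    and equivariance: "\<lbrakk>g \<in> carrier G; e \<in> carrier E\<rbrakk> \<Longrightarrow>
      \<partial> (g \<bullet> e) = g \<otimes>\<^bsub>G\<^esub> \<partial> e \<otimes>\<^bsub>G\<^esub> inv\<^bsub>G\<^esub> g"
    and peiffer: "\<lbrakk>e \<in> carrier E; f \<in> carrier E\<rbrakk> \<Longrightarrow>
      \<partial> e \<bullet> f = e \<otimes>\<^bsub>E\<^esub> f \<otimes>\<^bsub>E\<^esub> inv\<^bsub>E\<^esub> e"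

definition adjoint_action :: "('a, 'b) monoid_scheme \<Rightarrow> 'a \<Rightarrow> 'a \<Rightarrow> 'a" where
  "adjoint_action G g = (\<lambda>x\<in>carrier G. g \<otimes>\<^bsub>G\<^esub> x \<otimes>\<^bsub>G\<^esub> inv\<^bsub>G\<^esub> g)"

text \<open>A pair of functions satisfying the conditions (R2) and (R3) shared by the unframed and the
  framed notion.\<close>

locale reidemeister_moves = crossed_module E G bd act
  for E :: "('e, 'm) monoid_scheme" and G :: "('g, 'n) monoid_scheme"
    and bd :: "'e \<Rightarrow> 'g"  ("\<partial>")
    and act :: "'g \<Rightarrow> 'e \<Rightarrow> 'e"  (infixr "\<bullet>" 75) +
  fixes \<psi> \<phi> :: "'g \<Rightarrow> 'g \<Rightarrow> 'e"
  assumes psi_closed: "\<lbrakk>X \<in> carrier G; Y \<in> carrier G\<rbrakk> \<Longrightarrow> \<psi> X Y \<in> carrier E"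
    and phi_closed: "\<lbrakk>X \<in> carrier G; Y \<in> carrier G\<rbrakk> \<Longrightarrow> \<phi> X Y \<in> carrier E"
    and R2: "\<lbrakk>X \<in> carrier G; Y \<in> carrier G\<rbrakk> \<Longrightarrow>
      (let Z = inv\<^bsub>G\<^esub> X \<otimes>\<^bsub>G\<^esub> inv\<^bsub>G\<^esub> \<partial> (\<phi> X Y) \<otimes>\<^bsub>G\<^esub> Y \<otimes>\<^bsub>G\<^esub> X
       in \<phi> X Y \<otimes>\<^bsub>E\<^esub> \<psi> X Z = \<one>\<^bsub>E\<^esub>)"
    and R3: "\<lbrakk>X \<in> carrier G; Y \<in> carrier G; T \<in> carrier G\<rbrakk> \<Longrightarrow>
      (let Z = inv\<^bsub>G\<^esub> Y \<otimes>\<^bsub>G\<^esub> inv\<^bsub>G\<^esub> \<partial> (\<phi> Y X) \<otimes>\<^bsub>G\<^esub> X \<otimes>\<^bsub>G\<^esub> Y;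
           V = inv\<^bsub>G\<^esub> T \<otimes>\<^bsub>G\<^esub> inv\<^bsub>G\<^esub> \<partial> (\<phi> T Y) \<otimes>\<^bsub>G\<^esub> Y \<otimes>\<^bsub>G\<^esub> T;
           W = inv\<^bsub>G\<^esub> T \<otimes>\<^bsub>G\<^esub> inv\<^bsub>G\<^esub> \<partial> (\<phi> T X) \<otimes>\<^bsub>G\<^esub> X \<otimes>\<^bsub>G\<^esub> T
       in \<phi> Y X \<otimes>\<^bsub>E\<^esub> (Y \<bullet> \<phi> T Z) \<otimes>\<^bsub>E\<^esub> \<phi> T Y =
          (X \<bullet> \<phi> T Y) \<otimes>\<^bsub>E\<^esub> \<phi> T X \<otimes>\<^bsub>E\<^esub> (T \<bullet> \<phi> V W))"
begin

definition framing_f :: "'g \<Rightarrow> 'g" where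
  "framing_f Z = (THE A. A \<in> carrier G \<and> \<partial> (\<phi> A Z) \<otimes>\<^bsub>G\<^esub> A = Z)"

definition framing_g :: "'g \<Rightarrow> 'g" where
  "framing_g A = inv\<^bsub>G\<^esub> \<partial> (\<psi> A A) \<otimes>\<^bsub>G\<^esub> A"

end

locale unframed_reidemeister_pair = reidemeister_moves +
  assumes R1: "X \<in> carrier G \<Longrightarrow> \<psi> X X = \<one>\<^bsub>E\<^esub>"

locale framed_reidemeister_pair = reidemeister_moves +
  assumes framing_unique: "Z \<in> carrier G \<Longrightarrow>
      \<exists>!A. A \<in> carrier G \<and> \<partial> (\<phi> A Z) \<otimes>\<^bsub>G\<^esub> A = Z"
    and framing_f_g: "A \<in> carrier G \<Longrightarrow> framing_f (framing_g A) = A"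
    and framing_g_f: "Z \<in> carrier G \<Longrightarrow> framing_g (framing_f Z) = Z"

definition rack_psi :: "('a, 'b) monoid_scheme \<Rightarrow> ('a \<Rightarrow> 'a \<Rightarrow> 'a) \<Rightarrow> 'a \<Rightarrow> 'a \<Rightarrow> 'a" where
  "rack_psi G rtri b a = b \<otimes>\<^bsub>G\<^esub> a \<otimes>\<^bsub>G\<^esub> inv\<^bsub>G\<^esub> b \<otimes>\<^bsub>G\<^esub> inv\<^bsub>G\<^esub> (rtri b a)"

definition rack_phi :: "('a, 'b) monoid_scheme \<Rightarrow> ('a \<Rightarrow> 'a \<Rightarrow> 'a) \<Rightarrow> 'a \<Rightarrow> 'a \<Rightarrow> 'a" where
  "rack_phi G ltri b a = a \<otimes>\<^bsub>G\<^esub> b \<otimes>\<^bsub>G\<^esub> inv\<^bsub>G\<^esub> (ltri a b) \<otimes>\<^bsub>G\<^esub> inv\<^bsub>G\<^esub> b"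

end

theory Submission
  imports Defs
begin

text \<open>The definitions of \<open>\<phi>\<close> and \<open>\<psi>\<close> are chosen so that
  \<open>X\<^sup>-\<^sup>1 \<phi>(X,Y)\<^sup>-\<^sup>1 Y X = Y \<triangleleft> X\<close> and
  \<open>\<psi>(A,A)\<^sup>-\<^sup>1 A = A \<triangleright> A\<close>. By the first identity both sides of (R3) telescope,
  one to \<open>X Y T ((X \<triangleleft> Y) \<triangleleft> T)\<^sup>-\<^sup>1 (Y \<triangleleft> T)\<^sup>-\<^sup>1 T\<^sup>-\<^sup>1\<close>
  and the other to the same word with \<open>(X \<triangleleft> T) \<triangleleft> (Y \<triangleleft> T)\<close> in place of
  \<open>(X \<triangleleft> Y) \<triangleleft> T\<close>, so (R3) is self-distributivity. The framing equation becomes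
  \<open>Z \<triangleleft> A = A\<close>, whose only solution is \<open>A = Z \<triangleleft> Z\<close> because \<open>Z\<close> and
  \<open>Z \<triangleleft> Z\<close> act on the rack in the same way; and \<open>Z \<mapsto> Z \<triangleleft> Z\<close> is inverse
  to \<open>A \<mapsto> A \<triangleright> A\<close>.\<close>

context group
begin

lemma adjoint_action_apply:
  "x \<in> carrier G \<Longrightarrow> adjoint_action G g x = g \<otimes> x \<otimes> inv g"
  by (simp add: adjoint_action_def)

text \<open>Cancels inverse neighbours in words that \<open>m_assoc\<close> has bracketed to the
  right.\<close>

lemma inv_cancel_left [simp]:
  assumes "x \<in> carrier G" "y \<in> carrier G"
  shows "inv x \<otimes> (x \<otimes> y) = y" "x \<otimes> (inv x \<otimes> y) = y"
  using assms by (simp_all flip: m_assoc)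

text \<open>Conjugation is a homomorphism into \<open>BijGroup\<close>; multiplicativity of each
  conjugation places its values in \<open>AutoGroup\<close>.\<close>

lemma adjoint_action_hom: "adjoint_action G \<in> hom G (AutoGroup G)"
proof -
  have "adjoint_action G \<in> hom G (BijGroup (carrier G))"
    using conjugation_is_hom by (simp add: adjoint_action_def[abs_def])
  moreover have "adjoint_action G g \<in> hom G G" if "g \<in> carrier G" for g
    using that by (auto simp: hom_def adjoint_action_def m_assoc)
  ultimately show ?thesis
    by (auto simp: hom_def AutoGroup_def auto_def BijGroup_def)
qed

lemma adjoint_crossed_module: "crossed_module G G id (adjoint_action G)"
proof unfold_locales
  show "id \<in> hom G G"
    by (simp add: hom_def)
qed (simp_all add: adjoint_action_hom adjoint_action_apply)

end

text \<open>Write \<open>x\<close> as \<open>(z \<triangleright> x) \<triangleleft> z\<close> and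
  distribute a further \<open>\<triangleleft> z\<close> over it.\<close>

lemma (in rack) ltri_self:
  assumes "x \<in> R" "z \<in> R"
  shows "x \<triangleleft> (z \<triangleleft> z) = x \<triangleleft> z"
  using ltri_distrib[of "z \<triangleright> x" z z] assms by (simp add: ltri_rtri rtri_closed)

lemma (in rack) ltri_eq_iff:
  assumes "x \<in> R" "y \<in> R" "z \<in> R"
  shows "x \<triangleleft> y = z \<longleftrightarrow> y \<triangleright> z = x"
  using assms ltri_rtri rtri_ltri by auto

lemma (in rack) ltri_fixed_iff:
  assumes "z \<in> R" "a \<in> R"
  shows "z \<triangleleft> a = a \<longleftrightarrow> a = z \<triangleleft> z"
proof
  assume a: "z \<triangleleft> a = a"
  \<comment> \<open>Distributing over \<open>a = a \<triangleright> (a \<triangleleft> a)\<close>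
    gives \<open>a \<triangleright> a = (a \<triangleright> a) \<triangleright> a\<close>, and
    \<open>a \<triangleright> a\<close> is \<open>z\<close>.\<close>
  then have "z \<triangleright> a = a \<triangleright> a"
    using rtri_distrib[of a a "a \<triangleleft> a"] assms by (auto simp: ltri_eq_iff rtri_ltri ltri_closed)
  also have "\<dots> = z"
    using a assms by (simp add: ltri_eq_iff)
  finally show "a = z \<triangleleft> z"
    using ltri_rtri[of z a] assms by simp
qed (use assms ltri_self in simp)

locale group_on_rack = group G + rack "carrier G" rtri ltri
  for G (structure)
    and rtri :: "'a \<Rightarrow> 'a \<Rightarrow> 'a"  (infixl "\<triangleright>" 70)
    and ltri :: "'a \<Rightarrow> 'a \<Rightarrow> 'a"  (infixl "\<triangleleft>" 70)
begin

lemmas closed = rtri_closed ltri_closed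

lemma phi_closed: "\<lbrakk>X \<in> carrier G; Y \<in> carrier G\<rbrakk> \<Longrightarrow> rack_phi G ltri X Y \<in> carrier G"
  by (simp add: rack_phi_def closed)

lemma psi_closed: "\<lbrakk>X \<in> carrier G; Y \<in> carrier G\<rbrakk> \<Longrightarrow> rack_psi G rtri X Y \<in> carrier G"
  by (simp add: rack_psi_def closed)

lemma ltri_from_phi:
  assumes "X \<in> carrier G" "Y \<in> carrier G"
  shows "inv X \<otimes> inv rack_phi G ltri X Y \<otimes> Y \<otimes> X = Y \<triangleleft> X"
  using assms by (simp add: rack_phi_def closed m_assoc inv_mult_group)

lemma rtri_from_psi:
  assumes "X \<in> carrier G"
  shows "inv rack_psi G rtri X X \<otimes> X = X \<triangleright> X"
  using assms by (simp add: rack_psi_def closed m_assoc inv_mult_group)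

lemma phi_framing_iff:
  assumes "A \<in> carrier G" "Z \<in> carrier G"
  shows "rack_phi G ltri A Z \<otimes> A = Z \<longleftrightarrow> A = Z \<triangleleft> Z"
proof -
  have "rack_phi G ltri A Z \<otimes> A = Z \<longleftrightarrow> A \<otimes> inv (Z \<triangleleft> A) = \<one>"
    using assms by (simp add: rack_phi_def closed m_assoc)
  also have "\<dots> \<longleftrightarrow> Z \<triangleleft> A = A"
    using assms by (metis closed(2) inv_closed inv_equality inv_inv r_inv)
  finally show ?thesis
    using assms by (simp add: ltri_fixed_iff)
qed

lemma rack_pair_moves:
  "reidemeister_moves G G id (adjoint_action G) (rack_psi G rtri) (rack_phi G ltri)"
proof -
  interpret crossed_module G G id "adjoint_action G"
    by (rule adjoint_crossed_module)
  show ?thesis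
  proof (unfold_locales, goal_cases)
    case (3 X Y)
    \<comment> \<open>\<open>rack_phi\<close> stays folded until \<open>ltri_from_phi\<close> has
      turned \<open>Z\<close> into \<open>Y \<triangleleft> X\<close>; then
      \<open>X \<triangleright> (Y \<triangleleft> X) = Y\<close> makes the two factors mutually
      inverse.\<close>
    then show ?case
      by (simp add: ltri_from_phi Let_def)
        (simp add: rack_phi_def rack_psi_def closed rtri_ltri m_assoc)
  next
    case (4 X Y T)
    then show ?case
      by (simp add: ltri_from_phi Let_def phi_closed adjoint_action_apply closed)
        (simp add: rack_phi_def closed m_assoc flip: ltri_distrib)
  qed (simp_all add: psi_closed phi_closed)
qed

lemma rack_pair_framed:
  "framed_reidemeister_pair G G id (adjoint_action G) (rack_psi G rtri) (rack_phi G ltri)"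
proof -
  interpret reidemeister_moves G G id "adjoint_action G" "rack_psi G rtri" "rack_phi G ltri"
    by (rule rack_pair_moves)
  have g: "framing_g A = A \<triangleright> A" if "A \<in> carrier G" for A
    using that by (simp add: framing_g_def rtri_from_psi)
  have f: "framing_f Z = Z \<triangleleft> Z" if "Z \<in> carrier G" for Z
    unfolding framing_f_def using that by (auto simp: phi_framing_iff closed)
  show ?thesis
  proof unfold_locales
    fix Z assume Z: "Z \<in> carrier G"
    then show "\<exists>!A. A \<in> carrier G \<and> id (rack_phi G ltri A Z) \<otimes> A = Z"
      using phi_framing_iff by (auto simp: closed intro!: ex1I[of _ "Z \<triangleleft> Z"])
    \<comment> \<open>By \<open>ltri_eq_iff\<close> this says \<open>(Z \<triangleleft> Z)
      \<triangleright> (Z \<triangleleft> Z) = Z\<close>.\<close>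
    have "Z \<triangleleft> (Z \<triangleleft> Z) = Z \<triangleleft> Z"
      using Z by (simp add: ltri_self)
    then show "framing_g (framing_f Z) = Z"
      using Z by (simp add: f g closed ltri_eq_iff)
    \<comment> \<open>So \<open>Z\<close> solves the framing equation for
      \<open>Z \<triangleright> Z\<close>, and \<open>ltri_fixed_iff\<close> identifies it with the
      only solution.\<close>
    have "(Z \<triangleright> Z) \<triangleleft> Z = Z"
      using Z by (simp add: ltri_rtri)
    then show "framing_f (framing_g Z) = Z"
      using Z ltri_fixed_iff[of "Z \<triangleright> Z" Z] by (simp add: f g closed)
  qed
qed

lemma rack_pair_unframed:
  assumes "quandle (carrier G) rtri ltri"
  shows "unframed_reidemeister_pair G G id (adjoint_action G) (rack_psi G rtri) (rack_phi G ltri)"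
proof -
  interpret reidemeister_moves G G id "adjoint_action G" "rack_psi G rtri" "rack_phi G ltri"
    by (rule rack_pair_moves)
  show ?thesis
    by unfold_locales (simp add: rack_psi_def quandle.rtri_idem[OF assms] m_assoc)
qed

end

theorem theorem4p3:
  fixes R :: "'a set"
    and rtri ltri :: "'a \<Rightarrow> 'a \<Rightarrow> 'a"
    and G :: "('a, 'b) monoid_scheme"
  assumes "rack R rtri ltri" and "finite R"
    and "group G" and "carrier G = R"
  shows "framed_reidemeister_pair G G id (adjoint_action G) (rack_psi G rtri) (rack_phi G ltri) \<and>
    (quandle R rtri ltri \<longrightarrow>
      unframed_reidemeister_pair G G id (adjoint_action G) (rack_psi G rtri) (rack_phi G ltri))"
proof -
  interpret group_on_rack G rtri ltri
    using assms by (simp add: group_on_rack_def)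
  show ?thesis
    using rack_pair_framed rack_pair_unframed assms by simp
qed

end
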